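(* Let $G$ and $H$ be finite simple graphs with at least $4$ edges, let $\{G_i\}_{i\in I}$ and $\{H_i\}_{i\in I}$ be their single-edge-deleted subgraphs, indexed by a common index set $I$, and suppose there are isomorphisms $\gamma_i:G_i\to H_i$ for all $i\in I$. Work in the category $\mathbf{StGrphs}$. Let $\kappa_i:H_i\to H$ be the inclusions and let $\Gamma:\coprod_{i\in I}G_i\to H$ be the morphism induced by the maps $\kappa_i\gamma_i$ via the universal property of the coproduct. Let $p_0,p_1:\coprod_{i\in I}G_i\times\coprod_{i\in I}G_i\to\coprod_{i\in I}G_i$ be the product projections and let $k:R_\Gamma\to \coprod_{i\in I}G_i\times\coprod_{i\in I}G_i$ be the equalizer of $\Gamma p_0$ and $\Gamma p_1$. Then $G$ is edge-reconstructable if and only if there exists an epimorphism $\delta:\coprod_{i\in I}G_i\to G$ in $\mathbf{StGrphs}$ such that $\delta p_0k=\delta p_1k$.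
   Context: Here "$G$ is edge-reconstructable" means, in this setting, that $G$ is isomorphic to $H$. A graph $X$ has vertex set $V(X)$, edge set $E(X)$ and incidence function $\psi_X$ assigning each edge an unordered pair of (not necessarily distinct) vertices; the part set is $P(X)=E(X)\cup V(X)$, and $\psi_X(v)=\{v,v\}$ for vertices. A strict graph morphism $f:X\to Y$ is a function $P(X)\to P(Y)$ mapping vertices to vertices and edges to edges with $\psi_Y(f(e))=\{f(x),f(y)\}$ whenever $\psi_X(e)=\{x,y\}$. $\mathbf{StGrphs}$ is the category of all graphs (multiple edges and loops allowed) with strict graph morphisms. The coproduct is disjoint union. The product $X\times Y$ has vertex set $V(X)\times V(Y)$ and, for edges $e\in E(X)$ with $\psi_X(e)=\{a_1,a_2\}$ and $f\in E(Y)$ with $\psi_Y(f)=\{b_1,b_2\}$, an edge $(e,f)$ with ends $(a_1,b_1),(a_2,b_2)$ and, if $a_1\ne a_2$ and $b_1\ne b_2$, a further edge $\overline{(e,f)}$ with ends $(a_1,b_2),(a_2,b_1)$; the projections send $(u,v)$, $(e,f)$, $\overline{(e,f)}$ to their first (resp. second) coordinate. The equalizer of $f,g:X\to Y$ is the inclusion of the subgraph of $X$ consisting of those parts $a$ with $f(a)=g(a)$ and $f(a_j)=g(a_j)$ for the ends $a_1,a_2$ of $a$. *)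

theory Defs
  imports Main "HOL-Library.Uprod"
begin

text \<open>
  The vertices and edges of a graph are parts of one carrier type, so that a morphism is a single
  function on parts. Functions are total in HOL: only the values of a morphism on the parts of its
  domain matter, and two parallel morphisms are equal when they agree on these parts.
\<close>

record 'p graph =
  verts :: "'p set"
  edges :: "'p set"
  inc :: "'p \<Rightarrow> 'p uprod"

definition parts :: "'p graph \<Rightarrow> 'p set" where
  "parts X = edges X \<union> verts X"

definition wf_graph :: "'p graph \<Rightarrow> bool" where
  "wf_graph X \<longleftrightarrow>
     verts X \<inter> edges X = {} \<and>
     (\<forall>v\<in>verts X. inc X v = Upair v v) \<and>
     (\<forall>e\<in>edges X. set_uprod (inc X e) \<subseteq> verts X)"

definition simple_graph :: "'p graph \<Rightarrow> bool" where
  "simple_graph X \<longleftrightarrow>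
     wf_graph X \<and> (\<forall>e\<in>edges X. proper_uprod (inc X e)) \<and> inj_on (inc X) (edges X)"

definition finite_graph :: "'p graph \<Rightarrow> bool" where
  "finite_graph X \<longleftrightarrow> finite (verts X) \<and> finite (edges X)"

definition strict_hom :: "'p graph \<Rightarrow> 'q graph \<Rightarrow> ('p \<Rightarrow> 'q) set" where
  "strict_hom X Y = {f.
     (\<forall>v\<in>verts X. f v \<in> verts Y) \<and>
     (\<forall>e\<in>edges X. f e \<in> edges Y) \<and>
     (\<forall>e\<in>edges X. \<forall>x y. inc X e = Upair x y \<longrightarrow> inc Y (f e) = Upair (f x) (f y))}"

definition hom_eq :: "'p graph \<Rightarrow> ('p \<Rightarrow> 'q) \<Rightarrow> ('p \<Rightarrow> 'q) \<Rightarrow> bool" where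
  "hom_eq X f g \<longleftrightarrow> (\<forall>a\<in>parts X. f a = g a)"

definition graph_iso :: "'p graph \<Rightarrow> 'q graph \<Rightarrow> ('p \<Rightarrow> 'q) \<Rightarrow> bool" where
  "graph_iso X Y f \<longleftrightarrow>
     f \<in> strict_hom X Y \<and>
     (\<exists>g\<in>strict_hom Y X. hom_eq X (g \<circ> f) id \<and> hom_eq Y (f \<circ> g) id)"

definition isomorphic :: "'p graph \<Rightarrow> 'q graph \<Rightarrow> bool" where
  "isomorphic X Y \<longleftrightarrow> (\<exists>f. graph_iso X Y f)"

text \<open>
  HOL cannot quantify over the types of the test graphs Z. Graphs over the type 'q + 'q suffice,
  since it has room for two copies of Y; the theorem \<open>graph_epi_cancel\<close> below shows that an
  epimorphism in this sense is right-cancellable against test graphs over every type.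
\<close>

definition graph_epi :: "'p graph \<Rightarrow> 'q graph \<Rightarrow> ('p \<Rightarrow> 'q) \<Rightarrow> bool" where
  "graph_epi X Y f \<longleftrightarrow>
     f \<in> strict_hom X Y \<and>
     (\<forall>Z :: ('q + 'q) graph. wf_graph Z \<longrightarrow>
       (\<forall>g\<in>strict_hom Y Z. \<forall>h\<in>strict_hom Y Z.
          hom_eq X (g \<circ> f) (h \<circ> f) \<longrightarrow> hom_eq Y g h))"

definition coproduct :: "'i set \<Rightarrow> ('i \<Rightarrow> 'p graph) \<Rightarrow> ('i \<times> 'p) graph" where
  "coproduct I X = \<lparr>
     verts = (SIGMA i:I. verts (X i)),
     edges = (SIGMA i:I. edges (X i)),
     inc = (\<lambda>(i, a). map_uprod (Pair i) (inc (X i) a))\<rparr>"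

text \<open>The coproduct injections are the maps \<open>Pair i\<close>.\<close>

definition coproduct_induced :: "('i \<Rightarrow> 'p \<Rightarrow> 'q) \<Rightarrow> 'i \<times> 'p \<Rightarrow> 'q" where
  "coproduct_induced f = (\<lambda>(i, a). f i a)"

text \<open>
  The edges \<open>PEdge e f\<close> and \<open>PBar e f\<close> of the product depend on an enumeration of the two ends of
  \<open>e\<close> and of \<open>f\<close>; one is chosen for every edge. Another choice at most swaps the two names.
\<close>

definition some_ends :: "'p graph \<Rightarrow> 'p \<Rightarrow> 'p \<times> 'p" where
  "some_ends X e = (SOME (a, b). inc X e = Upair a b)"

datatype ('p, 'q) prod_part = PVert 'p 'q | PEdge 'p 'q | PBar 'p 'q

primrec product_inc ::
  "'p graph \<Rightarrow> 'q graph \<Rightarrow> ('p, 'q) prod_part \<Rightarrow> ('p, 'q) prod_part uprod" where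
  "product_inc X Y (PVert u v) = Upair (PVert u v) (PVert u v)"
| "product_inc X Y (PEdge e f) =
     (case (some_ends X e, some_ends Y f) of
        ((a\<^sub>1, a\<^sub>2), (b\<^sub>1, b\<^sub>2)) \<Rightarrow> Upair (PVert a\<^sub>1 b\<^sub>1) (PVert a\<^sub>2 b\<^sub>2))"
| "product_inc X Y (PBar e f) =
     (case (some_ends X e, some_ends Y f) of
        ((a\<^sub>1, a\<^sub>2), (b\<^sub>1, b\<^sub>2)) \<Rightarrow> Upair (PVert a\<^sub>1 b\<^sub>2) (PVert a\<^sub>2 b\<^sub>1))"

definition product :: "'p graph \<Rightarrow> 'q graph \<Rightarrow> ('p, 'q) prod_part graph" where
  "product X Y = \<lparr>
     verts = {PVert u v |u v. u \<in> verts X \<and> v \<in> verts Y},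
     edges = {PEdge e f |e f. e \<in> edges X \<and> f \<in> edges Y} \<union>
             {PBar e f |e f. e \<in> edges X \<and> f \<in> edges Y \<and>
                proper_uprod (inc X e) \<and> proper_uprod (inc Y f)},
     inc = product_inc X Y\<rparr>"

primrec proj0 :: "('p, 'q) prod_part \<Rightarrow> 'p" where
  "proj0 (PVert u v) = u"
| "proj0 (PEdge e f) = e"
| "proj0 (PBar e f) = e"

primrec proj1 :: "('p, 'q) prod_part \<Rightarrow> 'q" where
  "proj1 (PVert u v) = v"
| "proj1 (PEdge e f) = f"
| "proj1 (PBar e f) = f"

definition equalizer :: "'p graph \<Rightarrow> ('p \<Rightarrow> 'q) \<Rightarrow> ('p \<Rightarrow> 'q) \<Rightarrow> 'p graph" where
  "equalizer X f g = \<lparr>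
     verts = {a \<in> verts X. f a = g a \<and> (\<forall>x\<in>set_uprod (inc X a). f x = g x)},
     edges = {a \<in> edges X. f a = g a \<and> (\<forall>x\<in>set_uprod (inc X a). f x = g x)},
     inc = inc X\<rparr>"

text \<open>
  Subgraphs live over the carrier type of the ambient graph; their inclusions are given by \<open>id\<close>.
\<close>

definition delete_edge :: "'p graph \<Rightarrow> 'p \<Rightarrow> 'p graph" where
  "delete_edge X e = X\<lparr>edges := edges X - {e}\<rparr>"

text \<open>Each edge of X is deleted for exactly one index.\<close>

definition edge_deleted_subgraphs :: "'p graph \<Rightarrow> 'i set \<Rightarrow> ('i \<Rightarrow> 'p graph) \<Rightarrow> bool" where
  "edge_deleted_subgraphs X I Xs \<longleftrightarrow>
     (\<exists>d. bij_betw d I (edges X) \<and> (\<forall>i\<in>I. Xs i = delete_edge X (d i)))"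

lemma graph_epi_imp_surj:
  fixes X :: "'p graph" and Y :: "'q graph"
  assumes wfX: "wf_graph X" and wfY: "wf_graph Y" and epi: "graph_epi X Y f"
  shows "f ` parts X = parts Y"
proof -
  have f: "f \<in> strict_hom X Y"
    using epi by (simp add: graph_epi_def)
  have sub: "f ` parts X \<subseteq> parts Y"
    using f by (auto simp: strict_hom_def parts_def)
  let ?A = "f ` parts X"
  define g :: "'q \<Rightarrow> 'q + 'q" where "g = Inl"
  define h :: "'q \<Rightarrow> 'q + 'q" where "h = (\<lambda>b. if b \<in> ?A then Inl b else Inr b)"
  define Z :: "('q + 'q) graph" where
    "Z = \<lparr>verts = g ` verts Y \<union> h ` verts Y, edges = g ` edges Y \<union> h ` edges Y,
          inc = (\<lambda>z. case z of Inl b \<Rightarrow> map_uprod g (inc Y b) | Inr b \<Rightarrow> map_uprod h (inc Y b))\<rparr>"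
  have ends_in: "x \<in> ?A" if "b \<in> ?A" "b \<in> edges Y" "x \<in> set_uprod (inc Y b)" for b x
  proof -
    obtain a where a: "a \<in> parts X" "b = f a"
      using \<open>b \<in> ?A\<close> by blast
    have "a \<in> edges X"
      using a that(2) f wfY by (auto simp: strict_hom_def parts_def wf_graph_def)
    obtain u v where uv: "inc X a = Upair u v"
      by (cases "inc X a") auto
    then have "u \<in> parts X" "v \<in> parts X"
      using \<open>a \<in> edges X\<close> wfX by (fastforce simp: wf_graph_def parts_def)+
    moreover have "inc Y b = Upair (f u) (f v)"
      using uv f a \<open>a \<in> edges X\<close> by (auto simp: strict_hom_def)
    ultimately show ?thesis
      using that(3) by auto
  qed
  have wfZ: "wf_graph Z"
    unfolding wf_graph_def
  proof (intro conjI ballI)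
    show "verts Z \<inter> edges Z = {}"
      using wfY by (auto simp: Z_def wf_graph_def g_def h_def split: if_splits)
  next
    fix v assume "v \<in> verts Z"
    then show "inc Z v = Upair v v"
      using wfY by (auto simp: Z_def wf_graph_def g_def h_def split: if_splits)
  next
    fix e assume "e \<in> edges Z"
    then obtain b where b: "b \<in> edges Y" "e = Inl b \<or> e = Inr b"
      by (auto simp: Z_def g_def h_def split: if_splits)
    obtain x y where xy: "inc Y b = Upair x y"
      by (cases "inc Y b") auto
    then have "x \<in> verts Y" "y \<in> verts Y"
      using b wfY by (fastforce simp: wf_graph_def)+
    then show "set_uprod (inc Z e) \<subseteq> verts Z"
      using b xy by (auto simp: Z_def)
  qed
  have g: "g \<in> strict_hom Y Z"
    by (auto simp: strict_hom_def Z_def g_def)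
  have h: "h \<in> strict_hom Y Z"
    unfolding strict_hom_def
  proof (intro CollectI conjI ballI allI impI)
    fix e x y assume e: "e \<in> edges Y" and xy: "inc Y e = Upair x y"
    show "inc Z (h e) = Upair (h x) (h y)"
    proof (cases "e \<in> ?A")
      case True
      then have "x \<in> ?A" "y \<in> ?A"
        using ends_in[OF True e] xy by auto
      then show ?thesis
        using True xy by (auto simp: Z_def h_def g_def)
    next
      case False
      then show ?thesis
        using xy by (auto simp: Z_def h_def)
    qed
  qed (auto simp: Z_def)
  have "hom_eq X (g \<circ> f) (h \<circ> f)"
    by (auto simp: hom_eq_def g_def h_def)
  then have "hom_eq Y g h"
    using epi wfZ g h by (auto simp: graph_epi_def)
  then have "parts Y \<subseteq> ?A"
    by (auto simp: hom_eq_def g_def h_def split: if_splits)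
  with sub show ?thesis
    by blast
qed

theorem graph_epi_cancel:
  fixes X :: "'p graph" and Y :: "'q graph" and Z :: "'r graph"
  assumes "wf_graph X" and "wf_graph Y" and "graph_epi X Y f"
    and "wf_graph Z" and "g \<in> strict_hom Y Z" and "h \<in> strict_hom Y Z"
    and eq: "hom_eq X (g \<circ> f) (h \<circ> f)"
  shows "hom_eq Y g h"
  unfolding hom_eq_def
proof
  fix b assume "b \<in> parts Y"
  then obtain a where "a \<in> parts X" "b = f a"
    using graph_epi_imp_surj[OF assms(1-3)] by blast
  then show "g b = h b"
    using eq by (simp add: hom_eq_def)
qed

lemma coproduct_induced_hom:
  assumes "\<And>i. i \<in> I \<Longrightarrow> f i \<in> strict_hom (X i) Y"
  shows "coproduct_induced f \<in> strict_hom (coproduct I X) Y"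
  unfolding strict_hom_def
proof (intro CollectI conjI ballI allI impI)
  fix e x y
  assume e: "e \<in> edges (coproduct I X)" and xy: "inc (coproduct I X) e = Upair x y"
  obtain i a where ia: "e = (i, a)" "i \<in> I" "a \<in> edges (X i)"
    using e by (auto simp: coproduct_def)
  obtain u v where uv: "inc (X i) a = Upair u v"
    by (cases "inc (X i) a") auto
  have "inc Y (f i a) = Upair (f i u) (f i v)"
    using assms ia uv by (auto simp: strict_hom_def)
  moreover have "Upair (i, u) (i, v) = Upair x y"
    using xy uv ia by (simp add: coproduct_def)
  ultimately show "inc Y (coproduct_induced f e) =
      Upair (coproduct_induced f x) (coproduct_induced f y)"
    using ia by (auto simp: coproduct_induced_def)
qed (use assms in \<open>auto simp: coproduct_def coproduct_induced_def strict_hom_def\<close>)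

lemma coproduct_induced_unique:
  assumes "\<And>i. i \<in> I \<Longrightarrow> hom_eq (X i) (F \<circ> Pair i) (f i)"
  shows "hom_eq (coproduct I X) F (coproduct_induced f)"
  using assms by (auto simp: hom_eq_def parts_def coproduct_def coproduct_induced_def)

lemma inc_some_ends: "inc X e = Upair (fst (some_ends X e)) (snd (some_ends X e))"
proof -
  have "\<exists>p. case p of (a, b) \<Rightarrow> inc X e = Upair a b"
    by (cases "inc X e") auto
  then have "case some_ends X e of (a, b) \<Rightarrow> inc X e = Upair a b"
    unfolding some_ends_def by (rule someI_ex)
  then show ?thesis
    by (simp add: case_prod_beta)
qed

lemma wf_product:
  assumes "wf_graph X" and "wf_graph Y"
  shows "wf_graph (product X Y)"
proof -
  have X: "fst (some_ends X e) \<in> verts X" "snd (some_ends X e) \<in> verts X" if "e \<in> edges X" for e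
    using assms(1) that inc_some_ends[of X e] by (auto simp: wf_graph_def)
  have Y: "fst (some_ends Y e) \<in> verts Y" "snd (some_ends Y e) \<in> verts Y" if "e \<in> edges Y" for e
    using assms(2) that inc_some_ends[of Y e] by (auto simp: wf_graph_def)
  show ?thesis
    using X Y by (auto simp: wf_graph_def product_def case_prod_beta)
qed

lemma proj0_hom: "proj0 \<in> strict_hom (product X Y) X"
  using inc_some_ends[of X] by (auto simp: strict_hom_def product_def case_prod_beta)

lemma proj1_hom: "proj1 \<in> strict_hom (product X Y) Y"
  using inc_some_ends[of Y] by (auto simp: strict_hom_def product_def case_prod_beta)

end

theory Submission
  imports Defs
begin

text \<open>
  The fork \<open>R \<rightrightarrows> C\<close> is the kernel pair of \<open>\<Gamma>\<close>, and \<open>\<Gamma>\<close> is surjective on parts because every edge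
  of \<open>H\<close> survives in some \<open>H\<^sub>i\<close>. In StGrphs a morphism that is surjective on parts is the
  coequalizer of its kernel pair, so an epimorphism \<open>\<delta>\<close> with equal composites to \<open>G\<close> factors as
  \<open>\<delta> = \<phi>\<Gamma>\<close> with \<open>\<phi> : H \<rightarrow> G\<close> surjective. As \<open>G\<close> and \<open>H\<close> have equally many vertices and equally
  many edges, \<open>\<phi>\<close> is bijective on parts, hence an isomorphism. Conversely, an isomorphism
  \<open>\<psi> : H \<rightarrow> G\<close> yields \<open>\<delta> = \<psi>\<Gamma>\<close>.
\<close>

section \<open>Strict morphisms\<close>

lemma strict_homI:
  assumes "\<And>v. v \<in> verts X \<Longrightarrow> f v \<in> verts Y"
    and "\<And>e. e \<in> edges X \<Longrightarrow> f e \<in> edges Y"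
    and "\<And>e x y. e \<in> edges X \<Longrightarrow> inc X e = Upair x y \<Longrightarrow> inc Y (f e) = Upair (f x) (f y)"
  shows "f \<in> strict_hom X Y"
  using assms by (auto simp: strict_hom_def)

lemma strict_homD:
  assumes "f \<in> strict_hom X Y"
  shows strict_hom_verts: "v \<in> verts X \<Longrightarrow> f v \<in> verts Y"
    and strict_hom_edges: "e \<in> edges X \<Longrightarrow> f e \<in> edges Y"
    and strict_hom_inc: "e \<in> edges X \<Longrightarrow> inc X e = Upair x y \<Longrightarrow> inc Y (f e) = Upair (f x) (f y)"
    and strict_hom_parts: "a \<in> parts X \<Longrightarrow> f a \<in> parts Y"
  using assms by (auto simp: strict_hom_def parts_def)

lemma strict_hom_comp:
  assumes "f \<in> strict_hom X Y" and "g \<in> strict_hom Y Z"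
  shows "g \<circ> f \<in> strict_hom X Z"
  using assms by (auto simp: strict_hom_def)

lemma wf_graph_ends:
  assumes "wf_graph X" and "e \<in> edges X" and "inc X e = Upair x y"
  shows "x \<in> verts X" and "y \<in> verts X"
  using assms by (fastforce simp: wf_graph_def)+

text \<open>A strict morphism preserves sorts and \<open>Y\<close> has no part that is both vertex
  and edge, so the sort of \<open>f a\<close> determines that of \<open>a\<close>.\<close>

lemma strict_hom_vert_iff:
  assumes "f \<in> strict_hom X Y" and "wf_graph Y" and "a \<in> parts X"
  shows "f a \<in> verts Y \<longleftrightarrow> a \<in> verts X" and "f a \<in> edges Y \<longleftrightarrow> a \<in> edges X"
  using assms by (auto simp: strict_hom_def parts_def wf_graph_def)

text \<open>A preimage of a vertex can only be a vertex, and a preimage of an edge only an edge, by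
  \<open>strict_hom_vert_iff\<close>.\<close>

lemma surj_parts_imp_surj:
  assumes "f \<in> strict_hom X Y" and "wf_graph Y" and "f ` parts X = parts Y"
  shows "f ` verts X = verts Y" and "f ` edges X = edges Y"
proof -
  have "b \<in> f ` verts X" if "b \<in> verts Y" for b
  proof -
    have "b \<in> f ` parts X"
      using assms(3) that by (simp add: parts_def)
    then show ?thesis
      using strict_hom_vert_iff[OF assms(1,2)] that by blast
  qed
  then show "f ` verts X = verts Y"
    using strict_hom_verts[OF assms(1)] by blast
  have "b \<in> f ` edges X" if "b \<in> edges Y" for b
  proof -
    have "b \<in> f ` parts X"
      using assms(3) that by (simp add: parts_def)
    then show ?thesis
      using strict_hom_vert_iff[OF assms(1,2)] that by blast
  qed
  then show "f ` edges X = edges Y"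
    using strict_hom_edges[OF assms(1)] by blast
qed

section \<open>Isomorphisms and epimorphisms as bijections and surjections\<close>

lemma graph_iso_inverse:
  assumes "graph_iso X Y f"
  obtains g where "g \<in> strict_hom Y X" and "graph_iso Y X g"
    and "\<And>a. a \<in> parts X \<Longrightarrow> g (f a) = a" and "\<And>b. b \<in> parts Y \<Longrightarrow> f (g b) = b"
  using assms by (auto simp: graph_iso_def hom_eq_def)

lemma graph_iso_bij:
  assumes "graph_iso X Y f"
  shows "bij_betw f (verts X) (verts Y)" and "bij_betw f (edges X) (edges Y)"
proof -
  obtain g where g: "g \<in> strict_hom Y X"
    and inv: "\<And>a. a \<in> parts X \<Longrightarrow> g (f a) = a" "\<And>b. b \<in> parts Y \<Longrightarrow> f (g b) = b"
    using assms by (rule graph_iso_inverse) blast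
  have f: "f \<in> strict_hom X Y"
    using assms by (simp add: graph_iso_def)
  show "bij_betw f (verts X) (verts Y)" "bij_betw f (edges X) (edges Y)"
    by (rule bij_betw_byWitness[where f' = g];
        use f g inv in \<open>auto simp: strict_hom_def parts_def\<close>)+
qed

text \<open>The inverse map is automatically strict: an edge of \<open>Y\<close> has a unique
  preimage edge, whose ends are vertices of the well-formed \<open>X\<close> and are mapped by
  \<open>f\<close> onto the ends in \<open>Y\<close>.\<close>

lemma graph_iso_bijI:
  assumes wfX: "wf_graph X" and wfY: "wf_graph Y" and f: "f \<in> strict_hom X Y"
    and V: "bij_betw f (verts X) (verts Y)" and E: "bij_betw f (edges X) (edges Y)"
  shows "graph_iso X Y f"
proof -
  \<comment> \<open>Disjointness of the targets glues the two bijections into one on parts, so a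
    single inverse serves both sorts.\<close>
  have "verts Y \<inter> edges Y = {}"
    using wfY by (simp add: wf_graph_def)
  then have bij: "bij_betw f (parts X) (parts Y)"
    using bij_betw_combine[OF E V] by (auto simp: parts_def)
  define g where "g = inv_into (parts X) f"
  have gf: "g (f a) = a" if "a \<in> parts X" for a
    using bij that by (simp add: g_def bij_betw_inv_into_left)
  have fg: "f (g b) = b" if "b \<in> parts Y" for b
    using bij that by (simp add: g_def bij_betw_inv_into_right)
  have "g \<in> strict_hom Y X"
  proof (rule strict_homI)
    fix v assume "v \<in> verts Y"
    then obtain u where "u \<in> verts X" "v = f u"
      using V by (auto simp: bij_betw_def)
    then show "g v \<in> verts X"
      by (simp add: gf parts_def)
  next
    fix e assume "e \<in> edges Y"
    then obtain u where "u \<in> edges X" "e = f u"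
      using E by (auto simp: bij_betw_def)
    then show "g e \<in> edges X"
      by (simp add: gf parts_def)
  next
    fix e x y assume "e \<in> edges Y" and xy: "inc Y e = Upair x y"
    then obtain a where a: "a \<in> edges X" "e = f a"
      using E by (auto simp: bij_betw_def)
    obtain u v where uv: "inc X a = Upair u v"
      by (cases "inc X a") auto
    have "g (f u) = u" "g (f v) = v" "g e = a"
      using a wf_graph_ends[OF wfX a(1) uv] by (simp_all add: gf parts_def)
    moreover have "Upair (f u) (f v) = Upair x y"
      using strict_hom_inc[OF f a(1) uv] xy a by simp
    ultimately show "inc X (g e) = Upair (g x) (g y)"
      using uv by auto
  qed
  then show ?thesis
    using f gf fg by (auto simp: graph_iso_def hom_eq_def)
qed

text \<open>Converse of \<open>graph_epi_imp_surj\<close>; together they identify epimorphisms of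
  well-formed graphs with morphisms surjective on parts.\<close>

lemma graph_epi_surjI:
  assumes "f \<in> strict_hom X Y" and "f ` parts X = parts Y"
  shows "graph_epi X Y f"
proof -
  have "hom_eq Y g h" if "hom_eq X (g \<circ> f) (h \<circ> f)" for g h :: "'b \<Rightarrow> 'b + 'b"
    using that unfolding hom_eq_def assms(2)[symmetric] by auto
  then show ?thesis
    using assms(1) by (simp add: graph_epi_def)
qed

section \<open>Coproducts, kernel pairs and coequalizers\<close>

lemma wf_coproduct:
  assumes "\<And>i. i \<in> I \<Longrightarrow> wf_graph (X i)"
  shows "wf_graph (coproduct I X)"
  using assms by (fastforce simp: wf_graph_def coproduct_def uprod.set_map)

text \<open>The equalizer also constrains ends, so for two edges with the same image some product
  edge over them must pair their ends compatibly with \<open>q\<close>. Both images have the same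
  unordered ends, so either the straight pairing \<open>PEdge\<close> or the crossed pairing
  \<open>PBar\<close> does this.\<close>

lemma kernel_pair_relates:
  fixes X :: "'p graph" and q :: "'p \<Rightarrow> 'q"
  defines "R \<equiv> equalizer (product X X) (q \<circ> proj0) (q \<circ> proj1)"
  assumes wfY: "wf_graph Y" and q: "q \<in> strict_hom X Y"
    and x: "x \<in> parts X" and y: "y \<in> parts X" and eq: "q x = q y"
  obtains r where "r \<in> parts R" and "proj0 r = x" and "proj1 r = y"
proof (cases "x \<in> verts X")
  case True
  then have "y \<in> verts X"
    using strict_hom_vert_iff(1)[OF q wfY] x y eq by metis
  then have "PVert x y \<in> parts R"
    using True eq by (auto simp: R_def parts_def equalizer_def product_def)
  then show ?thesis
    by (rule that) simp_all
next
  case False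
  then have ex: "x \<in> edges X" and ey: "y \<in> edges X"
    using strict_hom_vert_iff(1)[OF q wfY] x y eq by (metis UnE parts_def)+
  obtain x1 x2 where xe: "some_ends X x = (x1, x2)"
    by fastforce
  obtain y1 y2 where ye: "some_ends X y = (y1, y2)"
    by fastforce
  have ix: "inc X x = Upair x1 x2" and iy: "inc X y = Upair y1 y2"
    using inc_some_ends[of X x] inc_some_ends[of X y] xe ye by simp_all
  have ends: "Upair (q x1) (q x2) = Upair (q y1) (q y2)"
    using strict_hom_inc[OF q ex ix] strict_hom_inc[OF q ey iy] eq by metis
  show ?thesis
  proof (cases "q x1 = q y1 \<and> q x2 = q y2")
    case True
    then have "PEdge x y \<in> parts R"
      using ex ey xe ye eq by (auto simp: R_def parts_def equalizer_def product_def)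
    then show ?thesis
      by (rule that) simp_all
  next
    case False
    \<comment> \<open>A loop would make all four ends agree under \<open>q\<close>, so both edges are proper and the
      second product edge exists.\<close>
    then have "q x1 = q y2" "q x2 = q y1" "x1 \<noteq> x2" "y1 \<noteq> y2"
      using ends by auto
    then have "PBar x y \<in> parts R"
      using ex ey xe ye ix iy eq by (auto simp: R_def parts_def equalizer_def product_def)
    then show ?thesis
      by (rule that) simp_all
  qed
qed

text \<open>By \<open>kernel_pair_relates\<close>, parts with the same image under \<open>q\<close>
  are related by the kernel pair, so \<open>d\<close> is constant on the fibres of \<open>q\<close>
  and descends to \<open>Y\<close>. Strictness of the descended map is checked on preimages of
  edges.\<close>

lemma surj_hom_coequalizes_kernel_pair:
  fixes X :: "'p graph" and Y :: "'q graph" and Z :: "'r graph"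
  assumes wfX: "wf_graph X" and wfY: "wf_graph Y"
    and q: "q \<in> strict_hom X Y" and surj: "q ` parts X = parts Y"
    and d: "d \<in> strict_hom X Z"
    and eq: "hom_eq (equalizer (product X X) (q \<circ> proj0) (q \<circ> proj1)) (d \<circ> proj0) (d \<circ> proj1)"
  obtains \<phi> where "\<phi> \<in> strict_hom Y Z" and "\<And>x. x \<in> parts X \<Longrightarrow> \<phi> (q x) = d x"
proof -
  have wd: "d x = d y" if xy: "x \<in> parts X" "y \<in> parts X" "q x = q y" for x y
  proof -
    obtain r where "r \<in> parts (equalizer (product X X) (q \<circ> proj0) (q \<circ> proj1))"
      "proj0 r = x" "proj1 r = y"
      using wfY q xy by (rule kernel_pair_relates)
    then show ?thesis
      using eq by (auto simp: hom_eq_def)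
  qed
  \<comment> \<open>An arbitrary preimage under \<open>q\<close> is chosen; \<open>wd\<close> makes
    the value independent of this choice.\<close>
  define \<phi> where "\<phi> = d \<circ> inv_into (parts X) q"
  have fac: "\<phi> (q x) = d x" if "x \<in> parts X" for x
  proof -
    have "q x \<in> q ` parts X"
      using that by simp
    then show ?thesis
      unfolding \<phi>_def comp_def
      by (intro wd that inv_into_into f_inv_into_f)
  qed
  note surj' = surj_parts_imp_surj[OF q wfY surj]
  have "\<phi> \<in> strict_hom Y Z"
  proof (rule strict_homI)
    fix v assume "v \<in> verts Y"
    then obtain u where "u \<in> verts X" "v = q u"
      using surj' by blast
    then show "\<phi> v \<in> verts Z"
      using d by (simp add: fac parts_def strict_hom_verts)
  next
    fix e assume "e \<in> edges Y"
    then obtain a where "a \<in> edges X" "e = q a"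
      using surj' by blast
    then show "\<phi> e \<in> edges Z"
      using d by (simp add: fac parts_def strict_hom_edges)
  next
    fix e x y assume "e \<in> edges Y" and xy: "inc Y e = Upair x y"
    then obtain a where a: "a \<in> edges X" "e = q a"
      using surj' by blast
    obtain u v where uv: "inc X a = Upair u v"
      by (cases "inc X a") auto
    have "\<phi> (q u) = d u" "\<phi> (q v) = d v" "\<phi> e = d a"
      using a wf_graph_ends[OF wfX a(1) uv] by (simp_all add: fac parts_def)
    moreover have "Upair (q u) (q v) = Upair x y"
      using strict_hom_inc[OF q a(1) uv] xy a by simp
    ultimately show "inc Z (\<phi> e) = Upair (\<phi> x) (\<phi> y)"
      using strict_hom_inc[OF d a(1) uv] by auto
  qed
  then show ?thesis
    using fac by (rule that)
qed

section \<open>Edge deletion and the equivalence\<close>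

lemma delete_edge_simps [simp]:
  "verts (delete_edge X e) = verts X"
  "edges (delete_edge X e) = edges X - {e}"
  "inc (delete_edge X e) = inc X"
  by (simp_all add: delete_edge_def)

lemma wf_delete_edge: "wf_graph X \<Longrightarrow> wf_graph (delete_edge X e)"
  by (auto simp: wf_graph_def)

lemma delete_edge_inclusion: "id \<in> strict_hom (delete_edge X e) X"
  by (auto simp: strict_hom_def)

theorem mainTheorem4:
  fixes G :: "'a graph" and H :: "'b graph"
    and I :: "'i set" and Gs :: "'i \<Rightarrow> 'a graph" and Hs :: "'i \<Rightarrow> 'b graph"
    and \<gamma> :: "'i \<Rightarrow> 'a \<Rightarrow> 'b" and \<kappa> :: "'i \<Rightarrow> 'b \<Rightarrow> 'b"
    and C :: "('i \<times> 'a) graph" and \<Gamma> :: "'i \<times> 'a \<Rightarrow> 'b"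
    and p\<^sub>0 p\<^sub>1 :: "('i \<times> 'a, 'i \<times> 'a) prod_part \<Rightarrow> 'i \<times> 'a"
    and R :: "('i \<times> 'a, 'i \<times> 'a) prod_part graph"
    and k :: "('i \<times> 'a, 'i \<times> 'a) prod_part \<Rightarrow> ('i \<times> 'a, 'i \<times> 'a) prod_part"
  assumes "finite_graph G" and "simple_graph G" and "card (edges G) \<ge> 4"
    and "finite_graph H" and "simple_graph H" and "card (edges H) \<ge> 4"
    and "edge_deleted_subgraphs G I Gs"
    and "edge_deleted_subgraphs H I Hs"
    and "\<And>i. i \<in> I \<Longrightarrow> graph_iso (Gs i) (Hs i) (\<gamma> i)"
  defines "\<kappa> \<equiv> \<lambda>i. id"
    and "C \<equiv> coproduct I Gs"
    and "\<Gamma> \<equiv> coproduct_induced (\<lambda>i. \<kappa> i \<circ> \<gamma> i)"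
    and "p\<^sub>0 \<equiv> proj0"
    and "p\<^sub>1 \<equiv> proj1"
    and "R \<equiv> equalizer (product C C) (\<Gamma> \<circ> p\<^sub>0) (\<Gamma> \<circ> p\<^sub>1)"
    and "k \<equiv> id"
  shows "isomorphic G H \<longleftrightarrow>
    (\<exists>\<delta>. graph_epi C G \<delta> \<and> hom_eq R (\<delta> \<circ> p\<^sub>0 \<circ> k) (\<delta> \<circ> p\<^sub>1 \<circ> k))"
proof -
  have wfG: "wf_graph G" and wfH: "wf_graph H"
    using assms(2,5) by (simp_all add: simple_graph_def)
  have finH: "finite (verts H)" "finite (edges H)"
    using assms(4) by (simp_all add: finite_graph_def)
  obtain c where c: "bij_betw c I (edges G)" "\<And>i. i \<in> I \<Longrightarrow> Gs i = delete_edge G (c i)"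
    using assms(7) by (auto simp: edge_deleted_subgraphs_def)
  obtain d where d: "bij_betw d I (edges H)" "\<And>i. i \<in> I \<Longrightarrow> Hs i = delete_edge H (d i)"
    using assms(8) by (auto simp: edge_deleted_subgraphs_def)
  note iso = assms(9)
  have wfC: "wf_graph C"
    unfolding C_def using wfG by (intro wf_coproduct) (simp add: c(2) wf_delete_edge)
  have \<Gamma>_simp: "\<Gamma> (i, a) = \<gamma> i a" for i a
    by (simp add: \<Gamma>_def coproduct_induced_def \<kappa>_def)
  have \<Gamma>: "\<Gamma> \<in> strict_hom C H"
    unfolding \<Gamma>_def C_def
  proof (rule coproduct_induced_hom)
    fix i assume "i \<in> I"
    then have "\<gamma> i \<in> strict_hom (Gs i) (Hs i)" "\<kappa> i \<in> strict_hom (Hs i) H"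
      using iso delete_edge_inclusion by (auto simp: graph_iso_def \<kappa>_def d(2))
    then show "\<kappa> i \<circ> \<gamma> i \<in> strict_hom (Gs i) H"
      by (rule strict_hom_comp)
  qed
  \<comment> \<open>Deleting an edge keeps all vertices, so each \<open>\<gamma> i\<close> already
    compares the full vertex sets of \<open>G\<close> and \<open>H\<close>.\<close>
  have \<gamma>_verts: "bij_betw (\<gamma> i) (verts G) (verts H)" if "i \<in> I" for i
    using graph_iso_bij(1)[OF iso[OF that]] that by (simp add: c(2) d(2))
  have \<gamma>_edges: "bij_betw (\<gamma> i) (edges G - {c i}) (edges H - {d i})" if "i \<in> I" for i
    using graph_iso_bij(2)[OF iso[OF that]] that by (simp add: c(2) d(2))
  \<comment> \<open>\<open>H\<close> has more than one edge and \<open>d\<close> reaches all of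
    them, so every part survives some deletion.\<close>
  have other: "\<exists>i\<in>I. d i \<noteq> b" for b
  proof (rule ccontr)
    assume "\<not> (\<exists>i\<in>I. d i \<noteq> b)"
    then have "edges H \<subseteq> {b}"
      using d(1) by (auto simp: bij_betw_def)
    then have "card (edges H) \<le> 1"
      using card_mono[of "{b}" "edges H"] by simp
    then show False
      using assms(6) by simp
  qed
  have surj: "\<Gamma> ` parts C = parts H"
  proof
    show "\<Gamma> ` parts C \<subseteq> parts H"
      using strict_hom_parts[OF \<Gamma>] by blast
    show "parts H \<subseteq> \<Gamma> ` parts C"
    proof
      fix b assume b: "b \<in> parts H"
      obtain i where i: "i \<in> I" "d i \<noteq> b"
        using other by blast
      have "b \<in> \<gamma> i ` parts (Gs i)"
      proof (cases "b \<in> verts H")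
        case True
        then show ?thesis
          using \<gamma>_verts[OF i(1)] i by (auto simp: bij_betw_def parts_def c(2))
      next
        case False
        then have "b \<in> \<gamma> i ` (edges G - {c i})"
          using \<gamma>_edges[OF i(1)] i b by (auto simp: bij_betw_def parts_def)
        then show ?thesis
          using i by (auto simp: parts_def c(2))
      qed
      then obtain a where "a \<in> parts (Gs i)" "b = \<Gamma> (i, a)"
        by (auto simp: \<Gamma>_simp)
      then show "b \<in> \<Gamma> ` parts C"
        using i by (auto simp: C_def coproduct_def parts_def)
    qed
  qed
  show ?thesis
  proof
    assume "isomorphic G H"
    then obtain f where "graph_iso G H f"
      by (auto simp: isomorphic_def)
    then obtain \<psi> where \<psi>: "\<psi> \<in> strict_hom H G" "graph_iso H G \<psi>"
      by (rule graph_iso_inverse) blast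
    have "\<psi> ` parts H = parts G"
      using graph_iso_bij[OF \<psi>(2)] by (simp add: bij_betw_def parts_def image_Un)
    then have "(\<psi> \<circ> \<Gamma>) ` parts C = parts G"
      by (metis image_comp surj)
    then have "graph_epi C G (\<psi> \<circ> \<Gamma>)"
      by (rule graph_epi_surjI[OF strict_hom_comp[OF \<Gamma> \<psi>(1)]])
    \<comment> \<open>On \<open>R\<close> the composites of \<open>\<Gamma>\<close> with the two
      projections agree by construction, and applying \<open>\<psi>\<close> keeps them
      equal.\<close>
    moreover have "hom_eq R (\<psi> \<circ> \<Gamma> \<circ> p\<^sub>0 \<circ> k) (\<psi> \<circ> \<Gamma> \<circ> p\<^sub>1 \<circ> k)"
      by (auto simp: hom_eq_def R_def equalizer_def parts_def k_def)
    ultimately show "\<exists>\<delta>. graph_epi C G \<delta> \<and> hom_eq R (\<delta> \<circ> p\<^sub>0 \<circ> k) (\<delta> \<circ> p\<^sub>1 \<circ> k)"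
      by blast
  next
    assume "\<exists>\<delta>. graph_epi C G \<delta> \<and> hom_eq R (\<delta> \<circ> p\<^sub>0 \<circ> k) (\<delta> \<circ> p\<^sub>1 \<circ> k)"
    then obtain \<delta> where epi: "graph_epi C G \<delta>"
      and eq: "hom_eq R (\<delta> \<circ> p\<^sub>0 \<circ> k) (\<delta> \<circ> p\<^sub>1 \<circ> k)"
      by blast
    have \<delta>: "\<delta> \<in> strict_hom C G"
      using epi by (simp add: graph_epi_def)
    have eq': "hom_eq (equalizer (product C C) (\<Gamma> \<circ> proj0) (\<Gamma> \<circ> proj1)) (\<delta> \<circ> proj0) (\<delta> \<circ> proj1)"
      using eq by (simp add: R_def k_def p\<^sub>0_def p\<^sub>1_def)
    obtain \<phi> where \<phi>: "\<phi> \<in> strict_hom H G" and fac: "\<And>x. x \<in> parts C \<Longrightarrow> \<phi> (\<Gamma> x) = \<delta> x"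
      using surj_hom_coequalizes_kernel_pair[OF wfC wfH \<Gamma> surj \<delta> eq'] by blast
    \<comment> \<open>As \<open>\<Gamma>\<close> is onto, \<open>\<phi>\<close> has the same image
      as \<open>\<delta>\<close>, and an epimorphism is onto.\<close>
    have "\<phi> ` parts H = \<delta> ` parts C"
      unfolding surj[symmetric] image_image by (intro image_cong) (simp_all add: fac)
    then have "\<phi> ` parts H = parts G"
      using graph_epi_imp_surj[OF wfC wfG epi] by simp
    note \<phi>_surj = surj_parts_imp_surj[OF \<phi> wfG this]
    obtain i where "i \<in> I"
      using other by blast
    have "card (verts H) = card (verts G)"
      using bij_betw_same_card[OF \<gamma>_verts[OF \<open>i \<in> I\<close>]] by simp
    \<comment> \<open>A surjection between finite sets of equal size is injective; the same argument
      gives \<open>E\<close>.\<close>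
    then have V: "bij_betw \<phi> (verts H) (verts G)"
      using \<phi>_surj(1) finH(1) by (simp add: bij_betw_def eq_card_imp_inj_on)
    \<comment> \<open>Both edge sets are in bijection with the common index set
      \<open>I\<close>.\<close>
    have "card (edges H) = card (edges G)"
      using bij_betw_same_card[OF c(1)] bij_betw_same_card[OF d(1)] by simp
    then have E: "bij_betw \<phi> (edges H) (edges G)"
      using \<phi>_surj(2) finH(2) by (simp add: bij_betw_def eq_card_imp_inj_on)
    obtain f where "graph_iso G H f"
      using graph_iso_bijI[OF wfH wfG \<phi> V E] by (rule graph_iso_inverse) blast
    then show "isomorphic G H"
      by (auto simp: isomorphic_def)
  qed
qed

end
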